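(* Let $A$ be a nonsingular $N\times N$ real matrix and let $\mathcal{L} = \{A\boldsymbol{\xi} : \boldsymbol{\xi}\in\mathbb{Z}^N\} \subseteq \mathbb{R}^N$. Define $\delta:\mathbb{R}^N\to[0,\infty)$ by $\delta(\mathbf{x}) = \max\{\sum_{m=1}^N x_m^+, \sum_{n=1}^N x_n^-\}$, where $x^+ = \max\{0,x\}$, $x^- = \max\{0,-x\}$. Then there exist linearly independent points $\boldsymbol{\ell}_1, \dots, \boldsymbol{\ell}_N$ in $\mathcal{L}$ such that \[ \prod_{n=1}^N \delta(\boldsymbol{\ell}_n) \le \frac{2^N (N!)^3}{(2N)!}\, |\det A|. \] *)

theory Defs
  imports "HOL-Analysis.Analysis"
begin

definition pos_part :: "real \<Rightarrow> real" where
  "pos_part x = max 0 x"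

definition neg_part :: "real \<Rightarrow> real" where
  "neg_part x = max 0 (- x)"

definition delta :: "real ^ 'n \<Rightarrow> real" where
  "delta x = max (\<Sum>m\<in>UNIV. pos_part (x $ m)) (\<Sum>n\<in>UNIV. neg_part (x $ n))"

definition lattice_of :: "real ^ 'n ^ 'n \<Rightarrow> (real ^ 'n) set" where
  "lattice_of A = {A *v \<xi> |\<xi>. \<forall>i. \<xi> $ i \<in> \<int>}"

end

theory Submission
  imports Defs
begin

text \<open>
  This is Minkowski's second theorem for the norm \<open>\<delta>\<close>, whose unit ball has volume
  \<open>(2N)! / (N!)\<^sup>3\<close>.

  Let \<open>\<lambda>\<^sub>k\<close> be the successive minima of a norm \<open>F\<close>, attained at \<open>l\<^sub>k\<close>, and use the \<open>l\<^sub>k\<close> as a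
  coordinate basis. On the open unit ball \<open>K\<close> put \<open>\<phi>(t) = \<Sum>\<^sub>j (\<lambda>\<^sub>j - \<lambda>\<^sub>j\<^sub>-\<^sub>1) c\<^sub>j(t)\<close>, where
  \<open>c\<^sub>j(t) \<in> K\<close> has the same coordinates as \<open>t\<close> from \<open>j\<close> on and depends on these only.
  If \<open>k\<close> is the last coordinate in which \<open>t\<close> and \<open>s\<close> differ, then \<open>u = (\<phi>(t) - \<phi>(s))/2\<close> has
  \<open>F\<close>-norm less than \<open>\<lambda>\<^sub>k\<close>, so if it is a lattice point, it lies in the span of the \<open>l\<^sub>j\<close> with
  \<open>j < k\<close>; but its \<open>k\<close>-th coordinate is \<open>\<lambda>\<^sub>k (t\<^sub>k - s\<^sub>k)/2 \<noteq> 0\<close>. Hence \<open>\<phi>/2\<close> is injective modulo the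
  lattice. In Minkowski's argument \<open>c\<^sub>j(t)\<close> is the centroid of a slice of \<open>K\<close>. Taking its first \<open>j - 1\<close>
  coordinates instead from the first point of a countable dense set that stays in \<open>K\<close> makes \<open>\<phi>\<close> on each of
  countably many Borel pieces equal to a fixed diagonal map plus a constant, so \<open>\<phi>\<close> multiplies volume by
  \<open>\<Prod>\<^sub>k \<lambda>\<^sub>k\<close>.
\<close>

section \<open>Lattices and flags\<close>

text \<open>The inverse of \<open>A\<close> keeps bounded sets bounded, and a bounded set holds
  finitely many integer vectors. This is why the successive minima are attained.\<close>

lemma finite_lattice_bounded:
  fixes A :: "real^'n^'n"
  assumes "invertible A" "bounded S"
  shows "finite (lattice_of A \<inter> S)"
proof -
  obtain R where "R ** A = mat 1"
    using assms(1) by (auto simp: invertible_def)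
  then have inv: "R *v (A *v x) = x" for x
    by (simp add: matrix_vector_mul_assoc)
  have "bounded ((*v) R ` S)"
    using assms(2) by (simp add: bounded_linear_image)
  then obtain c where c: "\<And>x. x \<in> S \<Longrightarrow> norm (R *v x) \<le> c"
    by (auto simp: bounded_iff)
  let ?Z = "real_of_int ` {-\<lceil>c\<rceil>..\<lceil>c\<rceil>}"
  let ?I = "vec_lambda ` (UNIV \<rightarrow>\<^sub>E ?Z) :: (real^'n) set"
  have "lattice_of A \<inter> S \<subseteq> (*v) A ` ?I"
  proof
    fix x assume "x \<in> lattice_of A \<inter> S"
    then obtain \<xi> where \<xi>: "x = A *v \<xi>" "\<And>i. \<xi> $ i \<in> \<int>" "x \<in> S"
      by (auto simp: lattice_of_def)
    have "\<xi> $ i \<in> ?Z" for i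
    proof -
      obtain z where z: "\<xi> $ i = of_int z" using \<xi>(2) Ints_cases by blast
      have "\<bar>\<xi> $ i\<bar> \<le> c"
        using c[OF \<xi>(3)] component_le_norm_cart[of \<xi> i] inv[of \<xi>] \<xi>(1) by simp
      then have "z \<in> {-\<lceil>c\<rceil>..\<lceil>c\<rceil>}" unfolding z by (auto simp: abs_le_iff) linarith+
      then show ?thesis using z by auto
    qed
    then have "vec_nth \<xi> \<in> UNIV \<rightarrow>\<^sub>E ?Z" by auto
    then have "\<xi> \<in> ?I" by (metis image_eqI vec_nth_inverse)
    then show "x \<in> (*v) A ` ?I" using \<xi>(1) by blast
  qed
  moreover have "finite ?I" by (intro finite_imageI finite_PiE) auto
  ultimately show ?thesis by (blast intro: finite_subset)
qed

text \<open>Otherwise the columns of \<open>A\<close> lie in \<open>span V\<close>, which is then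
  the whole space because \<open>A\<close> is surjective; but its dimension is at most
  \<open>card V\<close>.\<close>

lemma lattice_not_subset_span:
  fixes A :: "real^'n^'n"
  assumes "invertible A" "finite V" "card V < CARD('n)"
  shows "\<exists>x \<in> lattice_of A. x \<notin> span V"
proof (rule ccontr)
  assume "\<not> ?thesis"
  then have sub: "lattice_of A \<subseteq> span V" by auto
  have "A *v x \<in> span V" for x
  proof -
    have "A *v axis i 1 \<in> span V" for i
    proof (rule subsetD[OF sub])
      have "axis i (1::real) $ j \<in> \<int>" for j by (simp add: axis_def)
      then show "A *v axis i 1 \<in> lattice_of A" unfolding lattice_of_def by blast
    qed
    then have "(\<Sum>i\<in>UNIV. (x $ i) *\<^sub>R (A *v axis i 1)) \<in> span V"
      by (intro span_sum span_scale)
    also have "(\<Sum>i\<in>UNIV. (x $ i) *\<^sub>R (A *v axis i 1)) = A *v x"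
      by (simp add: matrix_vector_mult_basis) (simp add: matrix_mult_sum scalar_mult_eq_scaleR)
    finally show ?thesis .
  qed
  moreover obtain R where "A ** R = mat 1"
    using assms(1) by (auto simp: invertible_def)
  then have "x = A *v (R *v x)" for x
    by (simp add: matrix_vector_mul_assoc)
  ultimately have "span V = UNIV" by (metis UNIV_eq_I)
  then have "dim V = CARD('n)" by (metis dim_UNIV dim_span DIM_cart DIM_real mult.right_neutral)
  then show False using dim_le_card'[OF assms(2)] assms(3) by simp
qed

text \<open>Subtracting the terms with \<open>j < k\<close> leaves a multiple of \<open>l k\<close>
  in the span of the earlier vectors. This serves both the independence of the minima and the
  vanishing \<open>k\<close>-th coordinate in Minkowski's argument.\<close>

lemma triangular_coordinate_zero:
  fixes l :: "'n::{finite,wellorder} \<Rightarrow> 'v::real_vector"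
  assumes "l k \<notin> span (l ` {..<k})" "\<And>j. j > k \<Longrightarrow> t $ j = (0::real)"
    and "(\<Sum>j\<in>UNIV. t $ j *\<^sub>R l j) \<in> span (l ` {..<k})"
  shows "t $ k = 0"
proof (rule ccontr)
  assume nz: "t $ k \<noteq> 0"
  have "(\<Sum>j\<in>UNIV. t $ j *\<^sub>R l j) = (\<Sum>j\<in>{..k}. t $ j *\<^sub>R l j)"
    using assms(2) by (intro sum.mono_neutral_right) (auto simp: not_le)
  also have "{..k} = insert k {..<k}" by auto
  finally have "(\<Sum>j\<in>UNIV. t $ j *\<^sub>R l j) = t $ k *\<^sub>R l k + (\<Sum>j<k. t $ j *\<^sub>R l j)"
    by simp
  moreover have "(\<Sum>j<k. t $ j *\<^sub>R l j) \<in> span (l ` {..<k})"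
    by (intro span_sum span_scale span_base) auto
  ultimately have "t $ k *\<^sub>R l k \<in> span (l ` {..<k})"
    using assms(3) by (metis add_diff_cancel_right' span_diff)
  then have "(1 / t $ k) *\<^sub>R (t $ k *\<^sub>R l k) \<in> span (l ` {..<k})" by (rule span_scale)
  then show False using nz assms(1) by simp
qed

text \<open>These increments are the weights in \<phi>. Well-founded recursion defines them, the
  value before the least index counting as 0.\<close>

lemma partial_sum_increments:
  fixes a :: "'n::{finite,wellorder} \<Rightarrow> real"
  assumes "mono a" "\<And>k. a k \<ge> 0"
  obtains \<mu> where "\<And>k. \<mu> k \<ge> 0" "\<And>k. (\<Sum>j\<le>k. \<mu> j) = a k"
proof -
  have "\<exists>\<mu>. \<forall>k. \<mu> k = a k - (\<Sum>j<k. \<mu> j)"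
    by (rule dependent_wellorder_choice) (auto intro!: sum.cong)
  then obtain \<mu> where \<mu>: "\<And>k. \<mu> k = a k - (\<Sum>j<k. \<mu> j)" by blast
  have *: "{..k} = insert k {..<k}" for k :: 'n by auto
  have sum: "(\<Sum>j\<le>k. \<mu> j) = a k" for k
    unfolding * using \<mu>[of k] by simp
  have "\<mu> k \<ge> 0" for k
  proof (cases "{..<k} = {}")
    case True then show ?thesis using \<mu>[of k] assms(2) by simp
  next
    case False
    \<comment> \<open>\<open>p\<close> is the predecessor of \<open>k\<close>, so the sum over
      \<open>{..<k}\<close> is \<open>a p\<close>.\<close>
    define p where "p = Max {..<k}"
    have "p < k" using False Max_in[of "{..<k}"] by (simp add: p_def)
    moreover have "j \<le> p" if "j < k" for j using that by (simp add: p_def)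
    ultimately have "{..<k} = {..p}" by auto
    then show ?thesis using \<mu>[of k] sum[of p] assms(1) \<open>p < k\<close> by (simp add: monoD)
  qed
  then show ?thesis using sum that by blast
qed

text \<open>Cut \<open>S\<close> into the countably many pieces on which \<open>p\<close> is
  constant. There \<open>h\<close> is \<open>M\<close> followed by a translation and scales volume
  by \<open>\<bar>det M\<bar>\<close>; injectivity keeps the images disjoint, so their volumes add
  up inside \<open>Q\<close>.\<close>

lemma measure_piecewise_affine_le:
  fixes h :: "real^'n::{finite,wellorder} \<Rightarrow> real^'n::_" and p :: "real^'n::_ \<Rightarrow> 'c::countable"
  assumes S: "S \<in> lmeasurable"
    and P: "\<And>c. {x\<in>S. p x = c} \<in> sets lebesgue"
    and h: "\<And>x. x \<in> S \<Longrightarrow> h x = M *v x + w (p x)"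
    and inj: "inj_on h S" and Q: "h ` S \<subseteq> Q" "Q \<in> lmeasurable"
  shows "\<bar>det M\<bar> * measure lebesgue S \<le> measure lebesgue Q"
proof -
  define P where "P c = {x\<in>S. p x = c}" for c
  have Pm: "P c \<in> lmeasurable" for c
    using P[of c] S unfolding P_def by (rule fmeasurableI2[rotated 2]) auto
  have hP: "h ` P c = (+) (w c) ` ((*v) M ` P c)" for c
    using h by (force simp: P_def image_image add.commute)
  have lin: "(*v) M ` P c \<in> lmeasurable" for c
    by (rule measurable_linear_image) (use Pm in auto)
  have hPm: "h ` P c \<in> lmeasurable" for c
    unfolding hP by (intro measurable_translation lin)
  have "measure lebesgue (h ` P c) = \<bar>det M\<bar> * measure lebesgue (P c)" for c
    unfolding hP by (simp add: measure_translation measure_linear_image Pm)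
  then have em: "emeasure lebesgue (h ` P c) = \<bar>det M\<bar> * emeasure lebesgue (P c)" for c
    using Pm[of c] hPm[of c] by (simp add: emeasure_eq_measure2 ennreal_mult)
  have S_eq: "S = (\<Union>c. P c)" by (auto simp: P_def)
  have hS_eq: "h ` S = (\<Union>c. h ` P c)" by (auto simp: P_def)
  have "ennreal \<bar>det M\<bar> * emeasure lebesgue S = ennreal \<bar>det M\<bar> * (\<integral>\<^sup>+c. emeasure lebesgue (P c) \<partial>count_space UNIV)"
    unfolding S_eq using Pm
    by (subst emeasure_UN_countable) (auto simp: disjoint_family_on_def P_def)
  also have "\<dots> = (\<integral>\<^sup>+c. emeasure lebesgue (h ` P c) \<partial>count_space UNIV)"
    by (simp add: em nn_integral_cmult)
  also have "\<dots> = emeasure lebesgue (\<Union>c. h ` P c)"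
  proof (rule emeasure_UN_countable[symmetric])
    show "disjoint_family_on (\<lambda>c. h ` P c) UNIV"
      using inj by (auto simp: disjoint_family_on_def P_def dest: inj_onD)
  qed (use hPm in auto)
  also have "\<dots> \<le> emeasure lebesgue Q"
    using Q hS_eq by (intro emeasure_mono) auto
  finally show ?thesis
    using S Q(2) by (simp add: emeasure_eq_measure2 flip: ennreal_mult)
qed

section \<open>Minkowski's second theorem\<close>

locale norm_function =
  fixes F :: "'a::euclidean_space \<Rightarrow> real"
  assumes pos: "x \<noteq> 0 \<Longrightarrow> F x > 0"
    and scale: "F (c *\<^sub>R x) = \<bar>c\<bar> * F x"
    and triangle: "F (x + y) \<le> F x + F y"
begin

lemma zero: "F 0 = 0"
  using scale[of 0 0] by simp

lemma diff_le: "F (x - y) \<le> F x + F y"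
  using triangle[of x "- y"] scale[of "-1" y] by simp

lemma sum_le: "finite I \<Longrightarrow> F (\<Sum>i\<in>I. f i) \<le> (\<Sum>i\<in>I. F (f i))"
  by (induction I rule: finite_induct) (auto simp: zero intro: order_trans[OF triangle])

text \<open>Homogeneity and the triangle inequality make \<open>F\<close> convex, and a real convex
  function on a finite-dimensional space is continuous.\<close>

lemma continuous: "continuous_on S F"
proof -
  have "convex_on UNIV F"
    unfolding convex_on_def
  proof (intro conjI allI impI ballI)
    fix x y and u v :: real assume "0 \<le> u" "0 \<le> v"
    then show "F (u *\<^sub>R x + v *\<^sub>R y) \<le> u * F x + v * F y"
      using triangle[of "u *\<^sub>R x" "v *\<^sub>R y"] by (simp add: scale)
  qed simp
  then show ?thesis
    using convex_on_continuous[OF open_UNIV] continuous_on_subset by blast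
qed

lemma open_ball: "open {x. F x < c}"
  by (intro open_Collect_less continuous continuous_intros)

text \<open>By compactness \<open>F\<close> has a positive minimum \<open>F u\<close> on the unit
  sphere; homogeneity turns this into \<open>norm x * F u \<le> F x\<close>.\<close>

lemma bounded_ball: "bounded {x. F x \<le> c}"
proof -
  have "compact (sphere (0::'a) 1)" "sphere (0::'a) 1 \<noteq> {}" by auto
  from continuous_attains_inf[OF this continuous]
  obtain u :: 'a where u: "norm u = 1" and min: "\<And>v. norm v = 1 \<Longrightarrow> F u \<le> F v" by auto
  have Fu: "F u > 0" using u by (intro pos) auto
  have "norm x \<le> c / F u" if "F x \<le> c" for x
  proof (cases "x = 0")
    case True
    then show ?thesis using that Fu by (simp add: zero)
  next
    case False
    then have "F u \<le> F ((1 / norm x) *\<^sub>R x)" by (intro min) simp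
    also have "\<dots> = F x / norm x" by (simp add: scale)
    finally have "norm x * F u \<le> F x" using False by (simp add: field_simps)
    then show ?thesis using that Fu by (simp add: field_simps)
  qed
  then show ?thesis by (auto simp: bounded_iff)
qed

lemma lmeasurable_ball: "{x. F x < c} \<in> lmeasurable"
proof -
  have "bounded {x. F x < c}" by (rule bounded_subset[OF bounded_ball[of c]]) auto
  then show ?thesis using open_ball by (simp add: lmeasurable_open)
qed

end

lemma (in norm_function) norm_function_comp:
  assumes "linear f" "inj f"
  shows "norm_function (\<lambda>x. F (f x))"
proof
  show "F (f x) > 0" if "x \<noteq> 0" for x
    using that assms by (intro pos) (auto simp: linear_injective_0)
  show "F (f (c *\<^sub>R x)) = \<bar>c\<bar> * F (f x)" for c x
    using assms by (simp add: linear_scale scale)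
  show "F (f (x + y)) \<le> F (f x) + F (f y)" for x y
    using assms by (simp add: linear_add triangle)
qed

text \<open>Recursion on \<open>k\<close>: \<open>l k\<close> is an \<open>F\<close>-shortest
  lattice vector outside the span of the earlier choices.\<close>

lemma successive_minima_exist:
  fixes A :: "real^'n::{finite,wellorder}^'n::_"
  assumes "norm_function F" "invertible A"
  obtains l :: "'n \<Rightarrow> real^'n::_" where
    "\<And>k. l k \<in> lattice_of A" "\<And>k. l k \<notin> span (l ` {..<k})"
    "\<And>k x. x \<in> lattice_of A \<Longrightarrow> F x < F (l k) \<Longrightarrow> x \<in> span (l ` {..<k})"
proof -
  interpret norm_function F by fact
  let ?P = "\<lambda>(l :: 'n \<Rightarrow> real^'n::_) k r. r \<in> lattice_of A \<and> r \<notin> span (l ` {..<k}) \<and>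
    (\<forall>x\<in>lattice_of A. F x < F r \<longrightarrow> x \<in> span (l ` {..<k}))"
  have "\<exists>l. \<forall>k. ?P l k (l k)"
  proof (rule dependent_wellorder_choice)
    fix r :: "real^'n::_" and f g :: "'n \<Rightarrow> real^'n::_" and k
    assume "\<And>y. y < k \<Longrightarrow> f y = g y"
    then have "f ` {..<k} = g ` {..<k}" by auto
    then show "?P f k r = ?P g k r" by simp
  next
    fix f :: "'n \<Rightarrow> real^'n::_" and k
    let ?V = "span (f ` {..<k})"
    have "card (f ` {..<k}) \<le> card {..<k}" by (rule card_image_le) simp
    also have "\<dots> < CARD('n)" by (rule psubset_card_mono) auto
    finally obtain x0 where x0: "x0 \<in> lattice_of A" "x0 \<notin> ?V"
      using lattice_not_subset_span[OF assms(2), of "f ` {..<k}"] by auto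
    \<comment> \<open>Capping at \<open>F x0\<close> leaves finitely many candidates, and any vector
      shorter than the minimizer also obeys the cap.\<close>
    let ?T = "(lattice_of A \<inter> {x. F x \<le> F x0}) - ?V"
    have "finite ?T" "?T \<noteq> {}"
      using finite_lattice_bounded[OF assms(2) bounded_ball] x0 by auto
    then obtain r where r: "r \<in> ?T" "\<And>x. x \<in> ?T \<Longrightarrow> F r \<le> F x"
      using arg_min_if_finite(1) arg_min_least by metis
    have "x \<in> ?V" if "x \<in> lattice_of A" "F x < F r" for x
    proof (rule ccontr)
      assume "x \<notin> ?V"
      then have "x \<in> ?T" using that r(1) by auto
      then show False using r(2)[of x] that(2) by simp
    qed
    then have "?P f k r" using r(1) by blast
    then show "\<exists>r. ?P f k r" by blast
  qed
  then show ?thesis using that by blast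
qed

section \<open>The piecewise diagonal map\<close>

definition splice :: "'n::{finite,linorder} \<Rightarrow> real^'n::_ \<Rightarrow> real^'n::_ \<Rightarrow> real^'n::_" where
  "splice j y t = (\<chi> i. if i < j then y $ i else t $ i)"

text \<open>Here \<open>c\<^sub>j(t)\<close> is \<open>splice j (d (m j t)) t\<close>. The points
  \<open>y\<close> with \<open>splice j y t\<close> in \<open>K\<close> form an open set containing
  \<open>t\<close>, so a dense sequence meets it. Taking the least index makes the choice Borel and
  dependent on the coordinates from \<open>j\<close> on only.\<close>

lemma splice_selection:
  fixes K :: "(real^'n::{finite,wellorder}) set"
  assumes "open K"
  obtains d :: "nat \<Rightarrow> real^'n::_" and m :: "'n \<Rightarrow> real^'n::_ \<Rightarrow> nat" where
    "\<And>j t. t \<in> K \<Longrightarrow> splice j (d (m j t)) t \<in> K"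
    "\<And>j t s. (\<And>i. i \<ge> j \<Longrightarrow> t $ i = s $ i) \<Longrightarrow> m j t = m j s"
    "\<And>j. m j \<in> borel \<rightarrow>\<^sub>M count_space UNIV"
proof -
  obtain D :: "(real^'n::_) set" where D: "countable D" "\<And>X. open X \<Longrightarrow> X \<noteq> {} \<Longrightarrow> \<exists>d\<in>D. d \<in> X"
    using countable_dense_exists by metis
  define d where "d = from_nat_into D"
  define m where "m j t = (LEAST n. splice j (d n) t \<in> K)" for j and t :: "real^'n::_"
  have comp: "continuous_on UNIV (\<lambda>y. if i < j then y $ i else t $ i)"
    "continuous_on UNIV (\<lambda>t. if i < j then y $ i else t $ i)" for i j and y t :: "real^'n::_"
    by (cases "i < j"; simp add: continuous_on_component)+
  have cont: "continuous_on UNIV (\<lambda>y. splice j y t)" "continuous_on UNIV (splice j y)"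
    for j and y t :: "real^'n::_"
    unfolding splice_def by (intro continuous_on_vec_lambda comp)+
  show ?thesis
  proof
    fix j and t :: "real^'n::_" assume "t \<in> K"
    moreover have "splice j t t = t" by (simp add: splice_def vec_eq_iff)
    ultimately have "t \<in> (\<lambda>y. splice j y t) -` K" by simp
    moreover have "open ((\<lambda>y. splice j y t) -` K)"
      using assms by (intro open_vimage cont)
    ultimately obtain y where "y \<in> D" "splice j y t \<in> K" using D(2) by (metis empty_iff vimageE)
    then obtain n where "splice j (d n) t \<in> K"
      using from_nat_into_surj[OF D(1)] by (metis d_def)
    then show "splice j (d (m j t)) t \<in> K" unfolding m_def by (rule LeastI)
  next
    fix j and t s :: "real^'n::_" assume "\<And>i. i \<ge> j \<Longrightarrow> t $ i = s $ i"
    then have "splice j y t = splice j y s" for y by (simp add: splice_def vec_eq_iff)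
    then show "m j t = m j s" by (simp add: m_def)
  next
    fix j
    have "open (splice j (d n) -` K)" for n
      using assms by (intro open_vimage cont)
    then have "Measurable.pred borel (\<lambda>t. splice j (d n) t \<in> K)" for n
      by (simp add: pred_def vimage_def)
    then show "m j \<in> borel \<rightarrow>\<^sub>M count_space UNIV"
      unfolding m_def by (rule measurable_Least)
  qed
qed

text \<open>\<Lambda> stands for the lattice in the coordinates given by the minima, and its
  hypothesis is what minimality says there. \<open>p\<close> records the selected indices and has
  countably many values.\<close>

lemma minkowski_map_exists:
  fixes G :: "real^'n::{finite,wellorder} \<Rightarrow> real"
  assumes "norm_function G" and a: "mono a" "\<And>k. a k > 0"
    and \<Lambda>: "\<And>u k. u \<in> \<Lambda> \<Longrightarrow> G u < a k \<Longrightarrow> (\<And>j. j > k \<Longrightarrow> u $ j = 0) \<Longrightarrow> u $ k = 0"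
  obtains \<phi> and p :: "real^'n::_ \<Rightarrow> 'n \<Rightarrow> nat" and b where
    "\<And>t. \<phi> t = (\<chi> i. a i * t $ i) + b (p t)"
    "\<And>c. {t. p t = c} \<in> sets borel"
    "\<And>t s. G t < 1 \<Longrightarrow> G s < 1 \<Longrightarrow> (1/2) *\<^sub>R (\<phi> t - \<phi> s) \<in> \<Lambda> \<Longrightarrow> t = s"
proof -
  interpret norm_function G by fact
  obtain \<mu> where \<mu>: "\<And>k. \<mu> k \<ge> 0" "\<And>k. (\<Sum>j\<le>k. \<mu> j) = a k"
    using partial_sum_increments[OF a(1)] a(2) less_imp_le by metis
  obtain d :: "nat \<Rightarrow> real^'n::_" and m :: "'n \<Rightarrow> real^'n::_ \<Rightarrow> nat"
    where d: "\<And>j t. G t < 1 \<Longrightarrow> G (splice j (d (m j t)) t) < 1"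
    and m: "\<And>j t s. (\<And>i. i \<ge> j \<Longrightarrow> t $ i = s $ i) \<Longrightarrow> m j t = m j s"
    "\<And>j. m j \<in> borel \<rightarrow>\<^sub>M count_space UNIV"
    using splice_selection[OF open_ball[of 1]] unfolding mem_Collect_eq by blast
  define c where "c j t = splice j (d (m j t)) t" for j t
  define \<phi> where "\<phi> t = (\<Sum>j\<in>UNIV. \<mu> j *\<^sub>R c j t)" for t
  \<comment> \<open>In coordinate \<open>i\<close>, the summands with \<open>j \<le> i\<close>
    return \<open>t $ i\<close> with total weight \<open>a i\<close>; those with
    \<open>j > i\<close> take it from the dense sequence and are collected in
    \<open>b\<close>.\<close>
  define b :: "('n \<Rightarrow> nat) \<Rightarrow> real^'n::_" where "b q = (\<chi> i. \<Sum>j\<in>{i<..}. \<mu> j * d (q j) $ i)" for q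
  have c_ge: "c j t $ i = t $ i" if "j \<le> i" for i j t
    using that by (auto simp: c_def splice_def)
  have c_cong: "c j t = c j s" if "\<And>i. i \<ge> j \<Longrightarrow> t $ i = s $ i" for j t s
    using m(1)[OF that] that by (auto simp: c_def splice_def vec_eq_iff)
  show ?thesis
  proof
    fix t
    have "\<phi> t $ i = a i * t $ i + b (\<lambda>j. m j t) $ i" for i
    proof -
      have "\<phi> t $ i = (\<Sum>j\<in>UNIV. \<mu> j * c j t $ i)" by (simp add: \<phi>_def)
      also have "UNIV = {..i} \<union> {i<..}" by auto
      also have "(\<Sum>j\<in>{..i} \<union> {i<..}. \<mu> j * c j t $ i) =
        (\<Sum>j\<le>i. \<mu> j * c j t $ i) + (\<Sum>j\<in>{i<..}. \<mu> j * c j t $ i)"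
        by (rule sum.union_disjoint) auto
      also have "(\<Sum>j\<le>i. \<mu> j * c j t $ i) = a i * t $ i"
        by (simp add: c_ge \<mu>(2)[symmetric] sum_distrib_right)
      also have "(\<Sum>j\<in>{i<..}. \<mu> j * c j t $ i) = b (\<lambda>j. m j t) $ i"
        by (simp add: b_def c_def splice_def)
      finally show ?thesis .
    qed
    then show "\<phi> t = (\<chi> i. a i * t $ i) + b ((\<lambda>t j. m j t) t)"
      by (simp add: vec_eq_iff)
  next
    fix q
    have "{t. (\<lambda>j. m j t) = q} = (\<Inter>j. m j -` {q j} \<inter> space borel)"
      by (auto simp: fun_eq_iff)
    also have "\<dots> \<in> sets borel"
      by (intro sets.finite_INT measurable_sets[OF m(2)]) auto
    finally show "{t. (\<lambda>t j. m j t) t = q} \<in> sets borel" by simp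
  next
    fix t s assume ts: "G t < 1" "G s < 1" and mem: "(1/2) *\<^sub>R (\<phi> t - \<phi> s) \<in> \<Lambda>"
    show "t = s"
    proof (rule ccontr)
      assume "t \<noteq> s"
      define k where "k = Max {i. t $ i \<noteq> s $ i}"
      have "{i. t $ i \<noteq> s $ i} \<noteq> {}" using \<open>t \<noteq> s\<close> by (auto simp: vec_eq_iff)
      then have k: "t $ k \<noteq> s $ k" using Max_in[of "{i. t $ i \<noteq> s $ i}"] by (auto simp: k_def)
      have gt: "t $ i = s $ i" if "i > k" for i
      proof (rule ccontr)
        assume "t $ i \<noteq> s $ i"
        then have "i \<le> k" unfolding k_def by (intro Max_ge) auto
        then show False using that by simp
      qed
      let ?u = "(1/2) *\<^sub>R (\<phi> t - \<phi> s)"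
      have "\<phi> t - \<phi> s = (\<Sum>j\<in>UNIV. \<mu> j *\<^sub>R (c j t - c j s))"
        by (simp add: \<phi>_def sum_subtractf scaleR_diff_right)
      \<comment> \<open>For \<open>j > k\<close> the points \<open>c j t\<close> and
        \<open>c j s\<close> depend only on coordinates where \<open>t\<close> and \<open>s\<close>
        agree, so they cancel.\<close>
      also have "\<dots> = (\<Sum>j\<le>k. \<mu> j *\<^sub>R (c j t - c j s))"
      proof (rule sum.mono_neutral_right)
        have "c j t = c j s" if "j > k" for j
          using that gt by (intro c_cong) auto
        then show "\<forall>j\<in>UNIV - {..k}. \<mu> j *\<^sub>R (c j t - c j s) = 0" by auto
      qed auto
      finally have eq: "\<phi> t - \<phi> s = (\<Sum>j\<le>k. \<mu> j *\<^sub>R (c j t - c j s))" .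
      have coord: "?u $ i = a k * (t $ i - s $ i) / 2" if "i \<ge> k" for i
      proof -
        have "?u $ i = (\<Sum>j\<le>k. \<mu> j * (c j t $ i - c j s $ i)) / 2" by (simp add: eq)
        also have "(\<Sum>j\<le>k. \<mu> j * (c j t $ i - c j s $ i)) = (\<Sum>j\<le>k. \<mu> j * (t $ i - s $ i))"
          using that by (intro sum.cong) (auto simp: c_ge)
        finally show ?thesis by (simp add: \<mu>(2)[symmetric] sum_distrib_right)
      qed
      have cG: "G (c j t - c j s) < 2" for j
        using diff_le[of "c j t" "c j s"] d[OF ts(1), of j] d[OF ts(2), of j] by (simp add: c_def)
      have "G (\<phi> t - \<phi> s) \<le> (\<Sum>j\<le>k. \<mu> j * G (c j t - c j s))"
        unfolding eq using sum_le[of "{..k}" "\<lambda>j. \<mu> j *\<^sub>R (c j t - c j s)"] \<mu>(1) by (simp add: scale)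
      also have "\<dots> < (\<Sum>j\<le>k. \<mu> j * 2)"
      proof (rule sum_strict_mono_ex1)
        show "\<forall>j\<in>{..k}. \<mu> j * G (c j t - c j s) \<le> \<mu> j * 2"
          using \<mu>(1) by (intro ballI mult_left_mono less_imp_le[OF cG]) auto
        \<comment> \<open>The weights up to \<open>k\<close> add up to \<open>a k > 0\<close>, so
          one of them is positive and the inequality is strict.\<close>
        have "\<exists>j\<in>{..k}. \<mu> j \<noteq> 0"
          using \<mu>(2)[of k] a(2)[of k] by (metis less_irrefl sum.neutral)
        then obtain j where "j \<in> {..k}" "\<mu> j > 0" using \<mu>(1) by (metis less_le)
        then show "\<exists>j\<in>{..k}. \<mu> j * G (c j t - c j s) < \<mu> j * 2"
          using cG[of j] by (intro bexI[of _ j]) auto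
      qed simp
      also have "\<dots> = 2 * a k" by (simp add: \<mu>(2)[symmetric] sum_distrib_left mult.commute)
      finally have "G ?u < a k" by (simp add: scale)
      moreover have "?u $ j = 0" if "j > k" for j
        using coord[of j] gt[OF that] that by (simp del: vector_scaleR_component)
      ultimately have "?u $ k = 0" by (rule \<Lambda>[OF mem])
      then show False using coord[of k] k a(2)[of k] by simp
    qed
  qed
qed

text \<open>Written in integer coordinates of the lattice and reduced modulo integer vectors,
  \<phi>/2 becomes an injective map \<open>h\<close> from the ball of \<open>G\<close> into the unit
  cube. So \<open>\<bar>det M\<bar>\<close> times the volume of that ball is at most 1, and
  \<open>det M\<close> is the product of \<open>det R\<close>, \<open>det B\<close> and
  \<open>det D\<close>.\<close>

theorem minkowski_second_theorem:
  fixes A :: "real^'n::{finite,wellorder}^'n::_"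
  assumes "norm_function F" "invertible A"
  shows "\<exists>l :: 'n \<Rightarrow> real^'n::_. (\<forall>k. l k \<in> lattice_of A) \<and> inj l \<and> independent (range l) \<and>
    (\<Prod>k\<in>UNIV. F (l k)) * measure lebesgue {x. F x < 1} \<le> 2 ^ CARD('n) * \<bar>det A\<bar>"
proof -
  interpret norm_function F by fact
  obtain l :: "'n \<Rightarrow> real^'n::_" where l: "\<And>k. l k \<in> lattice_of A" "\<And>k. l k \<notin> span (l ` {..<k})"
    "\<And>k x. x \<in> lattice_of A \<Longrightarrow> F x < F (l k) \<Longrightarrow> x \<in> span (l ` {..<k})"
    using successive_minima_exist[OF assms] by blast
  define B :: "real^'n::_^'n::_" where "B = (\<chi> i j. l j $ i)"
  have col: "column j B = l j" for j by (simp add: column_def B_def)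
  have B_sum: "B *v t = (\<Sum>j\<in>UNIV. t $ j *\<^sub>R l j)" for t
    by (simp add: matrix_mult_sum scalar_mult_eq_scaleR col)
  have B_axis: "B *v axis j 1 = l j" for j
    by (simp add: matrix_vector_mult_basis col)
  have "t = 0" if "B *v t = 0" for t
  proof (rule ccontr)
    assume "t \<noteq> 0"
    then have ne: "{i. t $ i \<noteq> 0} \<noteq> {}" by (auto simp: vec_eq_iff)
    \<comment> \<open>The zero vector lies in every span, so the last nonzero coordinate would have
      to vanish.\<close>
    define k where "k = Max {i. t $ i \<noteq> 0}"
    have "t $ j = 0" if "j > k" for j
    proof (rule ccontr)
      assume "t $ j \<noteq> 0"
      then have "j \<le> k" unfolding k_def by (intro Max_ge) auto
      then show False using that by simp
    qed
    then have "t $ k = 0"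
      using that by (intro triangular_coordinate_zero[of l k t, OF l(2)]) (simp_all add: span_zero flip: B_sum)
    moreover have "t $ k \<noteq> 0" using Max_in[OF _ ne] by (simp add: k_def)
    ultimately show False by simp
  qed
  then have injB: "inj ((*v) B)" by (simp add: linear_injective_0)
  have rangeB: "range l = (*v) B ` range (\<lambda>i. axis i 1)" by (simp add: image_image B_axis)
  have "independent (range (\<lambda>i. axis i (1::real) :: real^'n::_))"
    by (rule independent_mono[OF independent_Basis]) (auto simp: Basis_vec_def)
  then have indep: "independent (range l)"
    unfolding rangeB by (intro linear_independent_injective_image inj_on_subset[OF injB]) auto
  have inj: "inj l"
  proof (rule injI)
    fix i j assume "l i = l j"
    then have "B *v axis i 1 = B *v axis j 1" by (simp add: B_axis)
    then have "axis i (1::real) = axis j 1" by (rule injD[OF injB])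
    then show "i = j" by (simp add: axis_eq_axis)
  qed
  define a where "a k = F (l k)" for k
  have a_pos: "a k > 0" for k
    using l(2)[of k] span_zero[of "l ` {..<k}"] unfolding a_def by (intro pos) auto
  \<comment> \<open>If a later minimum were shorter, minimality at \<open>i\<close> would put
    \<open>l j\<close> into the span of the vectors before \<open>i\<close>, hence of those before
    \<open>j\<close>.\<close>
  have "mono a"
  proof (rule monoI, rule ccontr)
    fix i j :: 'n assume "i \<le> j" "\<not> a i \<le> a j"
    then have "l j \<in> span (l ` {..<i})" using l(1,3) by (simp add: a_def)
    moreover have "span (l ` {..<i}) \<subseteq> span (l ` {..<j})"
      using \<open>i \<le> j\<close> by (intro span_mono image_mono) auto
    ultimately show False using l(2) by blast
  qed
  define G where "G t = F (B *v t)" for t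
  have G: "norm_function G"
    unfolding G_def using injB by (intro norm_function_comp) auto
  interpret G: norm_function G by (rule G)
  define \<Lambda> where "\<Lambda> = {u. B *v u \<in> lattice_of A}"
  have \<Lambda>: "u $ k = 0" if "u \<in> \<Lambda>" "G u < a k" "\<And>j. j > k \<Longrightarrow> u $ j = 0" for u k
  proof (rule triangular_coordinate_zero[of l k u, OF l(2) that(3)])
    show "(\<Sum>j\<in>UNIV. u $ j *\<^sub>R l j) \<in> span (l ` {..<k})"
      using that(1,2) unfolding B_sum[symmetric] by (intro l(3)) (auto simp: \<Lambda>_def G_def a_def)
  qed
  obtain \<phi> and p :: "real^'n::_ \<Rightarrow> 'n \<Rightarrow> nat" and b
    where \<phi>: "\<And>t. \<phi> t = (\<chi> i. a i * t $ i) + b (p t)"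
      and p: "\<And>c. {t. p t = c} \<in> sets borel"
      and \<phi>_inj: "\<And>t s. G t < 1 \<Longrightarrow> G s < 1 \<Longrightarrow> (1/2) *\<^sub>R (\<phi> t - \<phi> s) \<in> \<Lambda> \<Longrightarrow> t = s"
    by (rule minkowski_map_exists[OF G \<open>mono a\<close> a_pos, of \<Lambda>]) (rule \<Lambda>, assumption+, rule that)
  obtain R where R: "A ** R = mat 1"
    using assms(2) by (auto simp: invertible_def)
  \<comment> \<open>\<open>D\<close> is the linear part of \<phi>/2, and \<open>R\<close> inverts
    \<open>A\<close>, so that lattice points become integer vectors.\<close>
  define D :: "real^'n::_^'n::_" where "D = (\<chi> i j. if i = j then a i / 2 else 0)"
  define M where "M = R ** B ** D"
  have D: "D *v t = (1/2) *\<^sub>R (\<chi> i. a i * t $ i)" for t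
    by (simp add: D_def matrix_vector_mult_def vec_eq_iff if_distrib[of "\<lambda>x. x * _"] cong: if_cong)
  define g where "g t = R *v (B *v ((1/2) *\<^sub>R \<phi> t))" for t
  define v where "v q = R *v (B *v ((1/2) *\<^sub>R b q))" for q
  have g: "g t = M *v t + v (p t)" for t
    by (simp add: g_def v_def M_def \<phi> D matrix_vector_right_distrib scaleR_add_right
        flip: matrix_vector_mul_assoc)
  \<comment> \<open>\<open>h\<close> is the fractional part of \<open>g\<close>. The integer part
    \<open>z\<close> joins \<open>p\<close> as a label of the pieces, which stay countable in
    number.\<close>
  define z where "z t i = \<lfloor>g t $ i\<rfloor>" for t i
  define h where "h t = g t - (\<chi> i. of_int (z t i))" for t
  define w :: "('n \<Rightarrow> nat) \<times> ('n \<Rightarrow> int) \<Rightarrow> real^'n::_" where "w = (\<lambda>(q, z). v q - (\<chi> i. of_int (z i)))"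
  have "\<bar>det M\<bar> * measure lebesgue {t. G t < 1} \<le> measure lebesgue (cbox 0 (\<chi> i. 1) :: (real^'n::_) set)"
  proof (rule measure_piecewise_affine_le)
    show "h t = M *v t + w (p t, z t)" for t by (simp add: h_def w_def g)
    show "{t. G t < 1} \<in> lmeasurable" by (rule G.lmeasurable_ball)
    show "{t \<in> {t. G t < 1}. (p t, z t) = c} \<in> sets lebesgue" for c
    proof -
      obtain q y where c: "c = (q, y)" by (cases c)
      have z_eq: "z t = y \<longleftrightarrow> (\<forall>i. \<lfloor>g t $ i\<rfloor> = y i)" for t by (auto simp: fun_eq_iff z_def)
      \<comment> \<open>Where \<open>p t = q\<close>, the map \<open>g\<close> is affine with
        constant \<open>v q\<close>, so the floor conditions are Borel.\<close>
      let ?g = "\<lambda>i t. (M *v t + v q) $ i"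
      have g_meas [measurable]: "?g i \<in> borel_measurable borel" for i
        by (intro borel_measurable_continuous_onI continuous_intros)
      have "{t \<in> {t. G t < 1}. (p t, z t) = c} = {t. G t < 1} \<inter> {t. p t = q} \<inter> {t. \<forall>i\<in>UNIV. \<lfloor>?g i t\<rfloor> = y i}"
        by (auto simp: c g z_eq)
      also have "\<dots> \<in> sets borel"
      proof (intro sets.Int)
        show "{t. G t < 1} \<in> sets borel" using G.open_ball by simp
        show "{t. \<forall>i\<in>UNIV. \<lfloor>?g i t\<rfloor> = y i} \<in> sets borel" by measurable
      qed (rule p)
      finally show ?thesis by simp
    qed
    show "inj_on h {t. G t < 1}"
    proof (rule inj_onI)
      fix t s assume ts: "t \<in> {t. G t < 1}" "s \<in> {t. G t < 1}" and "h t = h s"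
      \<comment> \<open>Equal fractional parts leave an integer difference, which \<open>A\<close>
        sends to a lattice point.\<close>
      define \<xi> :: "real^'n::_" where "\<xi> = (\<chi> i. of_int (z t i - z s i))"
      have "g t - g s = \<xi>" using \<open>h t = h s\<close> by (simp add: h_def \<xi>_def vec_eq_iff algebra_simps)
      then have "R *v (B *v ((1/2) *\<^sub>R (\<phi> t - \<phi> s))) = \<xi>"
        by (simp add: g_def scaleR_diff_right matrix_vector_mult_diff_distrib)
      then have "A *v \<xi> = (A ** R) *v (B *v ((1/2) *\<^sub>R (\<phi> t - \<phi> s)))"
        by (simp flip: matrix_vector_mul_assoc)
      then have "B *v ((1/2) *\<^sub>R (\<phi> t - \<phi> s)) = A *v \<xi>" by (simp add: R)
      moreover have "\<xi> $ i \<in> \<int>" for i by (simp add: \<xi>_def)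
      ultimately have "(1/2) *\<^sub>R (\<phi> t - \<phi> s) \<in> \<Lambda>" unfolding \<Lambda>_def lattice_of_def by blast
      then show "t = s" using ts by (intro \<phi>_inj) auto
    qed
    show "h ` {t. G t < 1} \<subseteq> cbox 0 (\<chi> i. 1)"
      by (auto simp: h_def z_def mem_box_cart) linarith
  qed simp
  also have "measure lebesgue (cbox 0 (\<chi> i. 1) :: (real^'n::_) set) = 1"
  proof -
    have "(0 :: real^'n::_) \<in> cbox 0 (\<chi> i. 1)" by (simp add: mem_box_cart)
    then have "cbox 0 (\<chi> i. 1) \<noteq> ({} :: (real^'n::_) set)" by blast
    from content_cbox_cart[OF this] show ?thesis by simp
  qed
  finally have le: "\<bar>det M\<bar> * measure lebesgue {t. G t < 1} \<le> 1" .
  have "det D = (\<Prod>i\<in>UNIV. D $ i $ i)" by (rule det_diagonal) (simp add: D_def)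
  also have "\<dots> = (\<Prod>i\<in>UNIV. a i) / 2 ^ CARD('n)" by (simp add: D_def prod_dividef)
  finally have detD: "det D = (\<Prod>i\<in>UNIV. a i) / 2 ^ CARD('n)" .
  have detR: "\<bar>det A\<bar> * \<bar>det R\<bar> = 1"
    using R by (metis abs_mult abs_one det_I det_mul)
  have "{x. F x < 1} = (*v) B ` {t. G t < 1}"
  proof -
    have "surj ((*v) B)" using injB by (simp add: linear_injective_imp_surjective)
    then show ?thesis by (force simp: G_def)
  qed
  then have vol: "measure lebesgue {x. F x < 1} = \<bar>det B\<bar> * measure lebesgue {t. G t < 1}"
    using G.lmeasurable_ball by (simp add: measure_linear_image)
  have prod_pos: "(\<Prod>i\<in>UNIV. a i) > 0" using a_pos by (intro prod_pos) auto
  \<comment> \<open>Factors equal to 1 are inserted so that \<open>\<bar>det M\<bar>\<close> can be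
    assembled.\<close>
  have "(\<Prod>k\<in>UNIV. F (l k)) * measure lebesgue {x. F x < 1} =
      2 ^ CARD('n) * (\<bar>det A\<bar> * \<bar>det R\<bar>) * (\<Prod>k\<in>UNIV. a k) / 2 ^ CARD('n) *
      (\<bar>det B\<bar> * measure lebesgue {t. G t < 1})"
    unfolding detR vol by (simp add: a_def)
  also have "\<dots> = 2 ^ CARD('n) * \<bar>det A\<bar> * (\<bar>det M\<bar> * measure lebesgue {t. G t < 1})"
    using prod_pos by (simp add: M_def det_mul abs_mult detD)
  also have "\<dots> \<le> 2 ^ CARD('n) * \<bar>det A\<bar> * 1"
    using le by (intro mult_left_mono) auto
  finally show ?thesis using l(1) inj indep by auto
qed

section \<open>Volume of the unit ball\<close>

text \<open>
  The volume of \<open>{x. \<Sum> x\<^sub>i\<^sup>+ < s \<and> \<Sum> x\<^sub>i\<^sup>- < t}\<close> in dimension \<open>n\<close>: the sum is over the number \<open>k\<close> of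
  positive coordinates, and each orthant contributes a product of two simplices.
\<close>

definition delta_volume :: "nat \<Rightarrow> real \<Rightarrow> real \<Rightarrow> real" where
  "delta_volume n s t = (\<Sum>k\<le>n. real (n choose k) * (s ^ k / fact k) * (t ^ (n - k) / fact (n - k)))"

lemma delta_volume_nonneg: "s \<ge> 0 \<Longrightarrow> t \<ge> 0 \<Longrightarrow> delta_volume n s t \<ge> 0"
  by (simp add: delta_volume_def sum_nonneg)

lemma delta_volume_swap: "delta_volume n s t = delta_volume n t s"
proof -
  have "delta_volume n s t = (\<Sum>k\<le>n. real (n choose (n - k)) * (s ^ (n - k) / fact (n - k)) *
      (t ^ (n - (n - k)) / fact (n - (n - k))))"
    unfolding delta_volume_def by (rule sum.reindex_bij_witness[of _ "\<lambda>k. n - k" "\<lambda>k. n - k"]) auto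
  then show ?thesis
    unfolding delta_volume_def by (simp add: binomial_symmetric[symmetric] mult_ac)
qed

lemma borel_measurable_delta_volume [measurable]:
  "(\<lambda>y. delta_volume n (s - y) t) \<in> borel_measurable borel"
  unfolding delta_volume_def by measurable

text \<open>This integrates out one more positive coordinate \<open>y\<close>, which uses up
  \<open>y\<close> of the bound \<open>s\<close>. Termwise, the antiderivative in \<open>y\<close>
  is minus the right-hand sum at \<open>s - y\<close>.\<close>

lemma nn_integral_delta_volume:
  assumes "s \<ge> 0" "t \<ge> 0"
  shows "(\<integral>\<^sup>+y\<in>{0..s}. ennreal (delta_volume n (s - y) t) \<partial>lborel) =
    ennreal (\<Sum>k\<le>n. real (n choose k) * (s ^ Suc k / fact (Suc k)) * (t ^ (n - k) / fact (n - k)))"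
    (is "_ = ennreal (?P s)")
proof -
  have der: "((\<lambda>y. (s - y) ^ Suc k / fact (Suc k)) has_real_derivative - ((s - y) ^ k / fact k)) (at y)" for k y
  proof -
    have "((\<lambda>y. (s - y) ^ Suc k) has_real_derivative - (real (Suc k) * (s - y) ^ k)) (at y)"
      by (auto intro!: derivative_eq_intros simp del: power_Suc)
    from DERIV_cdivide[OF this, of "fact (Suc k)"] show ?thesis
      by (simp add: fact_Suc del: of_nat_Suc power_Suc)
  qed
  have "((\<lambda>y. - ?P (s - y)) has_real_derivative delta_volume n (s - y) t) (at y)" for y
  proof -
    have "((\<lambda>y. - ?P (s - y)) has_real_derivative
       - (\<Sum>k\<le>n. real (n choose k) * (- ((s - y) ^ k / fact k)) * (t ^ (n - k) / fact (n - k)))) (at y)"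
      by (intro DERIV_minus DERIV_sum DERIV_cmult DERIV_cmult_right der)
    then show ?thesis by (simp add: delta_volume_def sum_negf)
  qed
  then have "(\<integral>\<^sup>+y\<in>{0..s}. ennreal (delta_volume n (s - y) t) \<partial>lborel) =
      ennreal (- ?P (s - s) - - ?P (s - 0))"
    using assms by (intro nn_integral_FTC_Icc) (auto intro!: delta_volume_nonneg)
  then show ?thesis by simp
qed

text \<open>Pascal's rule splits the sum by the sign of the new coordinate: the first part comes
  from its positive values, the second, after reversing \<open>k\<close>, from its negative
  ones.\<close>

lemma delta_volume_Suc:
  "delta_volume (Suc n) s t =
     (\<Sum>k\<le>n. real (n choose k) * (s ^ Suc k / fact (Suc k)) * (t ^ (n - k) / fact (n - k))) +
     (\<Sum>k\<le>n. real (n choose k) * (t ^ Suc k / fact (Suc k)) * (s ^ (n - k) / fact (n - k)))"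
proof -
  let ?f = "\<lambda>k. (s ^ k / fact k) * (t ^ (Suc n - k) / fact (Suc n - k))"
  have "delta_volume (Suc n) s t = ?f 0 + (\<Sum>k\<le>n. real (Suc n choose Suc k) * ?f (Suc k))"
    unfolding delta_volume_def by (subst sum.atMost_Suc_shift) (simp add: mult.assoc)
  also have "\<dots> = (\<Sum>k\<le>n. real (n choose k) * ?f (Suc k)) +
      (?f 0 + (\<Sum>k\<le>n. real (n choose Suc k) * ?f (Suc k)))"
    by (simp only: binomial_Suc_Suc of_nat_add distrib_right sum.distrib add_ac)
  also have "?f 0 + (\<Sum>k\<le>n. real (n choose Suc k) * ?f (Suc k)) = (\<Sum>k\<le>Suc n. real (n choose k) * ?f k)"
    by (subst sum.atMost_Suc_shift) simp
  also have "\<dots> = (\<Sum>k\<le>n. real (n choose k) * ?f k)" by simp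
  also have "\<dots> = (\<Sum>k\<le>n. real (n choose (n - k)) * ?f (n - k))"
    by (rule sum.reindex_bij_witness[of _ "\<lambda>k. n - k" "\<lambda>k. n - k"]) auto
  also have "\<dots> = (\<Sum>k\<le>n. real (n choose k) * (t ^ Suc k / fact (Suc k)) * (s ^ (n - k) / fact (n - k)))"
    by (intro sum.cong refl) (simp add: binomial_symmetric[symmetric] Suc_diff_le mult_ac)
  finally show ?thesis by (simp add: mult.assoc)
qed

text \<open>Each summand is a squared binomial coefficient over \<open>fact n\<close>, and the
  squares add up to the central binomial coefficient.\<close>

lemma delta_volume_1_1: "delta_volume n 1 1 = fact (2 * n) / fact n ^ 3"
proof -
  have "delta_volume n 1 1 = (\<Sum>k\<le>n. real ((n choose k)\<^sup>2) / fact n)"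
    unfolding delta_volume_def
    by (intro sum.cong refl) (simp add: binomial_fact power2_eq_square)
  also have "\<dots> = real (\<Sum>k\<le>n. (n choose k)\<^sup>2) / fact n"
    by (simp add: sum_divide_distrib)
  also have "\<dots> = fact (2 * n) / fact n ^ 3"
    unfolding choose_square_sum by (simp add: binomial_fact power3_eq_cube)
  finally show ?thesis .
qed

section \<open>Lebesgue measure of the ball by Fubini\<close>

lemma measurable_pos_part [measurable]: "pos_part \<in> borel_measurable borel"
  and measurable_neg_part [measurable]: "neg_part \<in> borel_measurable borel"
  unfolding pos_part_def[abs_def] neg_part_def[abs_def] by measurable

text \<open>Induction on the coordinates: fixing the new one at \<open>y\<close> lowers
  \<open>s\<close> by \<open>y\<close> if \<open>y > 0\<close> and \<open>t\<close> by
  \<open>-y\<close> if \<open>y < 0\<close>, which is why the two bounds vary separately.\<close>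

lemma emeasure_delta_ball_PiM:
  assumes "finite A"
  shows "emeasure (Pi\<^sub>M A (\<lambda>_. lborel))
     {x \<in> space (Pi\<^sub>M A (\<lambda>_. lborel)). (\<Sum>i\<in>A. pos_part (x i)) < s \<and> (\<Sum>i\<in>A. neg_part (x i)) < t} =
     (if s > 0 \<and> t > 0 then ennreal (delta_volume (card A) s t) else 0)"
  using assms
proof (induction A arbitrary: s t rule: finite_induct)
  case empty
  then show ?case by (cases "s > 0 \<and> t > 0") (auto simp: PiM_empty delta_volume_def)
next
  case (insert b A)
  let ?M = "\<lambda>A. Pi\<^sub>M A (\<lambda>_. lborel)"
  define D where "D A s t = {x \<in> space (?M A). (\<Sum>i\<in>A. pos_part (x i)) < s \<and> (\<Sum>i\<in>A. neg_part (x i)) < t}"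
    for A :: "'a set" and s t
  have D_meas [measurable]: "D A s t \<in> sets (?M A)" if "finite A" for A s t
    unfolding D_def by measurable
  interpret product_sigma_finite "\<lambda>_. lborel" by standard
  have D_insert: "x(b := y) \<in> D (insert b A) s t \<longleftrightarrow> x \<in> D A (s - pos_part y) (t - neg_part y)"
    if "x \<in> space (?M A)" for x y
  proof -
    have "(\<Sum>i\<in>A. pos_part ((x(b := y)) i)) = (\<Sum>i\<in>A. pos_part (x i))"
      "(\<Sum>i\<in>A. neg_part ((x(b := y)) i)) = (\<Sum>i\<in>A. neg_part (x i))"
      using insert.hyps by (intro sum.cong; auto)+
    then show ?thesis
      using insert.hyps that by (auto simp: D_def space_PiM PiE_def extensional_def)
  qed
  let ?n = "card A"
  have "emeasure (?M (insert b A)) (D (insert b A) s t) =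
      (\<integral>\<^sup>+x. indicator (D (insert b A) s t) x \<partial>?M (insert b A))"
    using insert.hyps by simp
  also have "\<dots> = (\<integral>\<^sup>+y. \<integral>\<^sup>+x. indicator (D (insert b A) s t) (x(b := y)) \<partial>?M A \<partial>lborel)"
    using insert.hyps by (intro product_nn_integral_insert_rev) auto
  also have "\<dots> = (\<integral>\<^sup>+y. \<integral>\<^sup>+x. indicator (D A (s - pos_part y) (t - neg_part y)) x \<partial>?M A \<partial>lborel)"
    by (intro nn_integral_cong) (simp add: D_insert indicator_def)
  also have "\<dots> = (\<integral>\<^sup>+y. emeasure (?M A) (D A (s - pos_part y) (t - neg_part y)) \<partial>lborel)"
    using insert.hyps by simp
  also have "\<dots> = (\<integral>\<^sup>+y. (if s - pos_part y > 0 \<and> t - neg_part y > 0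
      then ennreal (delta_volume ?n (s - pos_part y) (t - neg_part y)) else 0) \<partial>lborel)"
    unfolding D_def insert.IH ..
  also have "\<dots> = (if s > 0 \<and> t > 0 then ennreal (delta_volume (Suc ?n) s t) else 0)"
  proof (cases "s > 0 \<and> t > 0")
    case True
    let ?g = "\<lambda>s t y. ennreal (delta_volume ?n (s - y) t) * indicator {0..s} y"
    have g_meas [measurable]: "?g s t \<in> borel_measurable lborel" for s t
      by measurable
    \<comment> \<open>At 0 both summands below count, and at \<open>s\<close> and \<open>-t\<close>
      the closed intervals exceed the strict conditions; these points are null.\<close>
    have "AE y in lborel. y \<noteq> 0 \<and> y \<noteq> s \<and> y \<noteq> - t"
      using AE_lborel_singleton[of 0] AE_lborel_singleton[of s] AE_lborel_singleton[of "-t"] by auto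
    then have "(\<integral>\<^sup>+y. (if s - pos_part y > 0 \<and> t - neg_part y > 0
        then ennreal (delta_volume ?n (s - pos_part y) (t - neg_part y)) else 0) \<partial>lborel) =
        (\<integral>\<^sup>+y. ?g s t y + ?g t s (- y) \<partial>lborel)"
      using True by (intro nn_integral_cong_AE, elim AE_mp)
        (auto intro!: AE_I2 simp: pos_part_def neg_part_def indicator_def max_def delta_volume_swap)
    also have "\<dots> = (\<integral>\<^sup>+y. ?g s t y \<partial>lborel) + (\<integral>\<^sup>+y. ?g t s (- y) \<partial>lborel)"
      by (rule nn_integral_add) measurable
    \<comment> \<open>Reflection turns the negative half into the positive one with \<open>s\<close>
      and \<open>t\<close> exchanged.\<close>
    also have "(\<integral>\<^sup>+y. ?g t s (- y) \<partial>lborel) = (\<integral>\<^sup>+y. ?g t s y \<partial>lborel)"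
      using nn_integral_real_affine[of "?g t s" "-1" 0] by simp
    finally show ?thesis
      using True by (simp add: nn_integral_delta_volume delta_volume_Suc sum_nonneg flip: ennreal_plus)
  next
    case False
    then have "\<not> (s - pos_part y > 0 \<and> t - neg_part y > 0)" for y
      by (auto simp: pos_part_def neg_part_def)
    then show ?thesis using False by (simp only: if_False) simp
  qed
  finally show ?case using insert.hyps by (simp add: D_def)
qed

text \<open>Lebesgue measure is the image of the product measure over \<open>Basis\<close> under
  summation of coordinates, so the ball pulls back to the set measured above.\<close>

lemma measure_delta_ball:
  "measure lebesgue {x :: real^'n. delta x < 1} = fact (2 * CARD('n)) / fact CARD('n) ^ 3"
proof -
  have [measurable]: "{x :: real^'n. delta x < 1} \<in> sets borel"
    unfolding delta_def by measurable
  let ?P = "Pi\<^sub>M Basis (\<lambda>_. lborel) :: (real^'n \<Rightarrow> real) measure"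
  let ?S = "\<lambda>f. \<Sum>b\<in>Basis. f b *\<^sub>R b :: real^'n"
  have Basis_sum: "(\<Sum>b\<in>Basis. g b) = (\<Sum>i\<in>UNIV. g (axis i 1))" for g :: "real^'n \<Rightarrow> real"
  proof -
    have *: "(Basis :: (real^'n) set) = range (\<lambda>i. axis i 1)" by (auto simp: Basis_vec_def)
    show ?thesis unfolding * by (subst sum.reindex) (auto simp: inj_on_def axis_eq_axis)
  qed
  have comp: "?S f $ i = f (axis i 1)" for f i
  proof -
    have "?S f $ i = ?S f \<bullet> axis i 1" by (simp add: inner_axis)
    then show ?thesis by (simp add: inner_sum_left_Basis)
  qed
  have delta_S: "delta (?S f) = max (\<Sum>b\<in>Basis. pos_part (f b)) (\<Sum>b\<in>Basis. neg_part (f b))" for f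
    unfolding delta_def comp by (simp add: Basis_sum)
  have "emeasure lborel {x :: real^'n. delta x < 1} = emeasure (distr ?P borel ?S) {x. delta x < 1}"
    by (subst lborel_eq) simp
  also have "\<dots> = emeasure ?P {f \<in> space ?P. (\<Sum>b\<in>Basis. pos_part (f b)) < 1 \<and> (\<Sum>b\<in>Basis. neg_part (f b)) < 1}"
    by (subst emeasure_distr) (auto simp: delta_S intro!: arg_cong[where f = "emeasure ?P"])
  also have "\<dots> = ennreal (delta_volume CARD('n) 1 1)"
    by (subst emeasure_delta_ball_PiM) simp_all
  finally show ?thesis
    by (simp add: measure_def delta_volume_1_1)
qed

section \<open>The norm \<open>delta\<close> and the bound for well-ordered indices\<close>

lemma norm_function_delta: "norm_function (delta :: real^'n \<Rightarrow> real)"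
proof
  have tri: "pos_part (a + b) \<le> pos_part a + pos_part b" "neg_part (a + b) \<le> neg_part a + neg_part b" for a b
    by (auto simp: pos_part_def neg_part_def)
  have nonneg: "pos_part a \<ge> 0" "neg_part a \<ge> 0" for a
    by (auto simp: pos_part_def neg_part_def)
  show "delta (x + y) \<le> delta x + delta y" for x y :: "real^'n"
  proof -
    have "(\<Sum>i\<in>UNIV. pos_part ((x + y) $ i)) \<le> (\<Sum>i\<in>UNIV. pos_part (x $ i)) + (\<Sum>i\<in>UNIV. pos_part (y $ i))"
      "(\<Sum>i\<in>UNIV. neg_part ((x + y) $ i)) \<le> (\<Sum>i\<in>UNIV. neg_part (x $ i)) + (\<Sum>i\<in>UNIV. neg_part (y $ i))"
      by (auto simp: tri simp flip: sum.distrib intro!: sum_mono)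
    then show ?thesis by (simp add: delta_def max_def)
  qed
  show "delta (c *\<^sub>R x) = \<bar>c\<bar> * delta x" for c and x :: "real^'n"
  proof (cases "c \<ge> 0")
    case True
    then have "pos_part (c * a) = c * pos_part a" "neg_part (c * a) = c * neg_part a" for a
      by (auto simp: pos_part_def neg_part_def max_mult_distrib_left)
    then show ?thesis
      using True by (simp add: delta_def max_mult_distrib_left flip: sum_distrib_left)
  next
    \<comment> \<open>A negative factor exchanges positive and negative parts, and the maximum is
      symmetric in them.\<close>
    case False
    then have "pos_part (c * a) = - c * neg_part a" "neg_part (c * a) = - c * pos_part a" for a
      by (auto simp: pos_part_def neg_part_def max_mult_distrib_left max_mult_distrib_right)
    moreover have "max (- c * u) (- c * v) = - c * max u v" for u v
      using False max_mult_distrib_left[of "- c" u v] by simp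
    ultimately show ?thesis
      using False by (simp add: delta_def max.commute sum_negf flip: sum_distrib_left)
  qed
  show "delta x > 0" if "x \<noteq> 0" for x :: "real^'n"
  proof -
    obtain i where "x $ i \<noteq> 0" using \<open>x \<noteq> 0\<close> by (auto simp: vec_eq_iff)
    then have "pos_part (x $ i) > 0 \<or> neg_part (x $ i) > 0"
      by (auto simp: pos_part_def neg_part_def)
    then have "(\<Sum>i\<in>UNIV. pos_part (x $ i)) > 0 \<or> (\<Sum>i\<in>UNIV. neg_part (x $ i)) > 0"
      using nonneg by (auto intro!: sum_pos2[of _ i])
    then show ?thesis by (auto simp: delta_def less_max_iff_disj)
  qed
qed

lemma delta_lattice_bound_wellorder:
  fixes A :: "real^'n::{finite,wellorder}^'n::_"
  assumes "invertible A"
  shows "\<exists>l :: 'n \<Rightarrow> real^'n::_.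
           (\<forall>n. l n \<in> lattice_of A) \<and>
           inj l \<and> independent (range l) \<and>
           (\<Prod>n\<in>UNIV. delta (l n))
             \<le> 2 ^ CARD('n) * (fact CARD('n)) ^ 3 / fact (2 * CARD('n)) * \<bar>det A\<bar>"
proof -
  obtain l :: "'n \<Rightarrow> real^'n::_" where l: "\<forall>k. l k \<in> lattice_of A" "inj l" "independent (range l)"
    and le: "(\<Prod>k\<in>UNIV. delta (l k)) * (fact (2 * CARD('n)) / fact CARD('n) ^ 3) \<le> 2 ^ CARD('n) * \<bar>det A\<bar>"
    using minkowski_second_theorem[OF norm_function_delta assms] unfolding measure_delta_ball by blast
  from le have "(\<Prod>k\<in>UNIV. delta (l k)) \<le> 2 ^ CARD('n) * (fact CARD('n)) ^ 3 / fact (2 * CARD('n)) * \<bar>det A\<bar>"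
    by (simp add: field_simps)
  then show ?thesis using l by blast
qed

section \<open>Arbitrary finite index types\<close>

text \<open>
  The library knows how linear maps scale Lebesgue measure only for well-ordered index types. An arbitrary
  finite index type is replaced by a copy of it that carries an order.
\<close>

typedef 'a wo = "UNIV :: 'a set" by simp

text \<open>The order on the copy is pulled back along an arbitrary injection into the naturals,
  which also gives well-foundedness.\<close>

definition wo_rank :: "'a wo \<Rightarrow> nat" where
  "wo_rank x = (SOME f :: 'a \<Rightarrow> nat. inj f) (Rep_wo x)"

lemma bij_Rep_wo: "bij Rep_wo"
  by (rule bij_betw_byWitness[of _ Abs_wo]) (auto simp: Rep_wo_inverse Abs_wo_inverse)

lemma inj_wo_rank: "inj (wo_rank :: 'a::finite wo \<Rightarrow> nat)"
proof -
  have "\<exists>f :: 'a \<Rightarrow> nat. inj f" using finite_imp_inj_to_nat_seg[of "UNIV :: 'a set"] by auto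
  then have "inj (SOME f :: 'a \<Rightarrow> nat. inj f)" by (rule someI_ex)
  then have "inj ((SOME f :: 'a \<Rightarrow> nat. inj f) \<circ> Rep_wo)"
    using bij_is_inj[OF bij_Rep_wo] by (rule inj_compose)
  moreover have "wo_rank = (SOME f :: 'a \<Rightarrow> nat. inj f) \<circ> Rep_wo"
    by (rule ext) (simp only: wo_rank_def comp_apply)
  ultimately show ?thesis by (simp only:)
qed

instance wo :: (finite) finite
proof
  show "finite (UNIV :: 'a wo set)"
    using bij_betw_finite[of "Rep_wo :: 'a wo \<Rightarrow> 'a" UNIV UNIV] bij_Rep_wo by simp
qed

instantiation wo :: (finite) wellorder
begin

definition less_eq_wo :: "'a wo \<Rightarrow> 'a wo \<Rightarrow> bool" where "x \<le> y \<longleftrightarrow> wo_rank x \<le> wo_rank y"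
definition less_wo :: "'a wo \<Rightarrow> 'a wo \<Rightarrow> bool" where "x < y \<longleftrightarrow> wo_rank x < wo_rank y"

instance
proof
  fix x y z :: "'a wo"
  show "x < y \<longleftrightarrow> x \<le> y \<and> \<not> y \<le> x" "x \<le> x" "x \<le> y \<or> y \<le> x"
    by (simp_all add: less_eq_wo_def less_wo_def less_le_not_le linear)
  show "x \<le> y \<Longrightarrow> y \<le> z \<Longrightarrow> x \<le> z" by (simp add: less_eq_wo_def)
  show "x \<le> y \<Longrightarrow> y \<le> x \<Longrightarrow> x = y"
    by (rule injD[OF inj_wo_rank]) (simp add: less_eq_wo_def)
next
  fix P and a :: "'a wo"
  assume "\<And>x :: 'a wo. (\<And>y. y < x \<Longrightarrow> P y) \<Longrightarrow> P x"
  then show "P a"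
    by (rule measure_induct_rule[of wo_rank P a]) (simp add: less_wo_def)
qed

end

text \<open>Conjugation by \<open>f\<close> matches the permutations of the two index types and
  preserves signs, so the Leibniz sums agree term by term.\<close>

lemma det_reindex:
  fixes A :: "'c::comm_ring_1^'n^'n" and f :: "'m::finite \<Rightarrow> 'n::finite"
  assumes "bij f"
  shows "det (\<chi> i j. A $ f i $ f j) = det A"
proof -
  let ?c = "map_permutation UNIV f"
  have inj: "inj f" and surj: "range f = UNIV" using assms by (auto simp: bij_def)
  have app: "?c p (f i) = f (p i)" if "p permutes UNIV" for p i
    using inj by (simp add: map_permutation_apply)
  have perm: "?c p permutes UNIV" if "p permutes UNIV" for p
    using map_permutation_permutes[of f UNIV UNIV p] assms that by simp
  have "bij_betw ?c {p. p permutes UNIV} {p. p permutes UNIV}"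
  proof (rule bij_betw_imageI)
    show "inj_on ?c {p. p permutes UNIV}"
    proof (rule inj_onI)
      fix p q assume pq: "p \<in> {p. p permutes UNIV}" "q \<in> {p. p permutes UNIV}" "?c p = ?c q"
      have "f (p i) = f (q i)" for i using app[of p i] app[of q i] pq by simp
      then show "p = q" using inj by (simp add: fun_eq_iff inj_eq)
    qed
    have "\<exists>p. p permutes UNIV \<and> q = ?c p" if q: "q permutes UNIV" for q
    proof -
      define p where "p = inv f \<circ> q \<circ> f"
      have "bij p" unfolding p_def using assms q
        by (intro bij_comp bij_imp_bij_inv) (auto dest: permutes_bij)
      then have p: "p permutes UNIV" by (intro bij_imp_permutes) auto
      have "?c p x = q x" for x
      proof -
        obtain i where "x = f i" using surj by auto
        then show ?thesis using app[OF p] surj by (simp add: p_def surj_f_inv_f)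
      qed
      then have "q = ?c p" by (simp add: fun_eq_iff)
      then show ?thesis using p by blast
    qed
    then show "?c ` {p. p permutes UNIV} = {p. p permutes UNIV}" using perm by auto
  qed
  then have "det A = (\<Sum>p | p permutes UNIV. of_int (sign (?c p)) * (\<Prod>i\<in>UNIV. A $ i $ ?c p i))"
    unfolding det_def by (rule sum.reindex_bij_betw[symmetric])
  also have "\<dots> = (\<Sum>p | p permutes UNIV. of_int (sign p) * (\<Prod>i\<in>UNIV. A $ f i $ f (p i)))"
  proof (rule sum.cong[OF refl])
    fix p :: "'m \<Rightarrow> 'm" assume "p \<in> {p. p permutes UNIV}"
    then have p: "p permutes UNIV" by simp
    have "(\<Prod>i\<in>UNIV. A $ i $ ?c p i) = (\<Prod>i\<in>UNIV. A $ f i $ ?c p (f i))"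
      by (rule prod.reindex_bij_betw[OF assms, symmetric])
    then show "of_int (sign (?c p)) * (\<Prod>i\<in>UNIV. A $ i $ ?c p i) =
        of_int (sign p) * (\<Prod>i\<in>UNIV. A $ f i $ f (p i))"
      using p inj by (simp add: app sign_map_permutation)
  qed
  also have "\<dots> = det (\<chi> i j. A $ f i $ f j)" by (simp add: det_def)
  finally show ?thesis by simp
qed

theorem theorem4p2:
  fixes A :: "real ^ 'n ^ 'n"
  assumes "invertible A"
  shows "\<exists>l :: 'n \<Rightarrow> real ^ 'n.
           (\<forall>n. l n \<in> lattice_of A) \<and>
           inj l \<and> independent (range l) \<and>
           (\<Prod>n\<in>UNIV. delta (l n))
             \<le> 2 ^ CARD('n) * (fact CARD('n)) ^ 3 / fact (2 * CARD('n)) * \<bar>det A\<bar>"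
proof -
  let ?r = "Rep_wo :: 'n wo \<Rightarrow> 'n"
  have bij: "bij ?r" by (rule bij_Rep_wo)
  have card: "CARD('n wo) = CARD('n)" using bij by (rule bij_betw_same_card)
  define A' :: "real ^ 'n wo ^ 'n wo" where "A' = (\<chi> i j. A $ ?r i $ ?r j)"
  have det: "det A' = det A" unfolding A'_def by (rule det_reindex[OF bij])
  then have "invertible A'" using assms by (simp add: invertible_det_nz)
  then obtain l :: "'n wo \<Rightarrow> real ^ 'n wo" where l: "\<And>k. l k \<in> lattice_of A'" "inj l" "independent (range l)"
    "(\<Prod>k\<in>UNIV. delta (l k)) \<le> 2 ^ CARD('n) * (fact CARD('n)) ^ 3 / fact (2 * CARD('n)) * \<bar>det A\<bar>"
    using delta_lattice_bound_wellorder[of A'] unfolding card det by blast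
  \<comment> \<open>\<open>T\<close> relabels coordinates. It is linear and injective, preserves
    \<open>delta\<close> and carries the lattice of \<open>A'\<close> into that of \<open>A\<close>,
    so the vectors found for \<open>A'\<close> can be moved over.\<close>
  define T :: "real ^ 'n wo \<Rightarrow> real ^ 'n" where "T x = (\<chi> i. x $ Abs_wo i)" for x
  have lin: "linear T" by (intro linearI) (auto simp: T_def vec_eq_iff)
  have T_nth: "T x $ ?r i = x $ i" for x i by (simp add: T_def Rep_wo_inverse)
  have inj: "inj T" by (rule injI) (metis T_nth vec_eq_iff)
  have delta_T: "delta (T x) = delta x" for x
    unfolding delta_def by (simp add: T_nth flip: sum.reindex_bij_betw[OF bij])
  have T_mult: "T (A' *v \<xi>) = A *v T \<xi>" for \<xi>
  proof -
    have "T (A' *v \<xi>) $ ?r i = (A *v T \<xi>) $ ?r i" for i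
      by (simp add: T_nth matrix_vector_mult_def A'_def flip: sum.reindex_bij_betw[OF bij])
    then have "T (A' *v \<xi>) $ i = (A *v T \<xi>) $ i" for i by (metis Abs_wo_inverse UNIV_I)
    then show ?thesis by (simp add: vec_eq_iff)
  qed
  have T_lattice: "T x \<in> lattice_of A" if "x \<in> lattice_of A'" for x
  proof -
    obtain \<xi> where "x = A' *v \<xi>" "\<And>i. \<xi> $ i \<in> \<int>" using \<open>x \<in> lattice_of A'\<close> by (auto simp: lattice_of_def)
    moreover from this have "T \<xi> $ i \<in> \<int>" for i by (simp add: T_def)
    ultimately show ?thesis unfolding lattice_of_def using T_mult by blast
  qed
  have bij': "bij (Abs_wo :: 'n \<Rightarrow> 'n wo)"
    by (rule bij_betw_byWitness[of _ Rep_wo]) (auto simp: Rep_wo_inverse Abs_wo_inverse)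
  define l' where "l' i = T (l (Abs_wo i))" for i
  show ?thesis
  proof (intro exI[of _ l'] conjI allI)
    show "l' n \<in> lattice_of A" for n using T_lattice l(1) by (simp add: l'_def)
    show "inj l'"
      unfolding l'_def using inj l(2) bij_is_inj[OF bij'] by (simp add: inj_def)
    have "range l' = T ` l ` range Abs_wo" by (auto simp: l'_def)
    then have range: "range l' = T ` range l" using bij' by (simp add: bij_def)
    show "independent (range l')"
      unfolding range by (intro linear_independent_injective_image inj_on_subset[OF inj] lin l(3)) simp
    have "(\<Prod>n\<in>UNIV. delta (l' n)) = (\<Prod>k\<in>UNIV. delta (l k))"
      using prod.reindex_bij_betw[OF bij', of "\<lambda>k. delta (l k)"] by (simp add: l'_def delta_T)
    then show "(\<Prod>n\<in>UNIV. delta (l' n))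
        \<le> 2 ^ CARD('n) * (fact CARD('n)) ^ 3 / fact (2 * CARD('n)) * \<bar>det A\<bar>"
      using l(4) by simp
  qed
qed

end
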